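(* Let $N\geq 2$ be an integer, and let $D(N)$ be the number of pairs of integers $(d,i)$ with $d\geq 1$, $i\geq 2$, and $N=\frac{d(d+i)}{i-1}$. Then $D(2)=1$, $D(3)=D(4)=2$, and for $N\geq 5$ one has $$3\le D(N)\le M(N)=(\sigma_0(N)-1)(\sigma_0(N+1)-1).$$
   Context: $\sigma_0$ is the divisor function: $\sigma_0(n)=\sum_{d\mid n}d^0$ is the number of positive divisors of the positive integer $n$. *)

theory Defs
  imports Complex_Main
begin

(* Only meaningful for n > 0: for n = 0 the index set is infinite and the sum is 0. *)
definition sigma0 :: "nat \<Rightarrow> nat" where
  "sigma0 n = (\<Sum>d | d dvd n. d ^ 0)"

definition sol_pairs :: "nat \<Rightarrow> (int \<times> int) set" where
  "sol_pairs N = {(d, i). d \<ge> 1 \<and> i \<ge> 2 \<and>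
     real N = real_of_int (d * (d + i)) / real_of_int (i - 1)}"

(* card yields 0 on infinite sets, so a positive lower bound on D_count N
   also expresses that there are finitely many pairs. *)
definition D_count :: "nat \<Rightarrow> nat" where
  "D_count N = card (sol_pairs N)"

(* Integer-valued, so that the subtractions are not truncated. *)
definition M_bound :: "nat \<Rightarrow> int" where
  "M_bound N = (int (sigma0 N) - 1) * (int (sigma0 (N + 1)) - 1)"

end

theory Submission
  imports Defs
begin

text \<open>
  Put \<open>e = N - d\<close>. Clearing denominators turns \<open>N = d (d + i) / (i - 1)\<close> into
  \<open>(i - 1) e = d (d + 1)\<close>. As \<open>d\<close> and \<open>i - 1\<close> are positive, \<open>0 < e < N\<close>; the equation then
  determines \<open>i\<close>, and it is solvable exactly when \<open>e\<close> divides \<open>d (d + 1)\<close>. Since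
  \<open>d \<equiv> N\<close> modulo \<open>e\<close>, this says that \<open>e\<close> divides \<open>N (N + 1)\<close>. Hence \<open>D(N)\<close> is the number of
  divisors of \<open>N (N + 1)\<close> that are smaller than \<open>N\<close> (\<open>D_count_eq_card_small_divisors\<close>).

  The values at \<open>2, 3, 4\<close> are then read off. For \<open>N \<ge> 5\<close> the numbers \<open>1\<close>, \<open>2\<close>, and the half of
  whichever of \<open>N\<close>, \<open>N + 1\<close> is even, are three such divisors. For the upper bound, every divisor
  of \<open>N (N + 1)\<close> is a product \<open>a b\<close> with \<open>a dvd N\<close> and \<open>b dvd N + 1\<close>, and \<open>a b < N\<close> excludes
  both \<open>a = N\<close> and \<open>b = N + 1\<close>, which leaves \<open>(\<sigma>\<^sub>0(N) - 1) (\<sigma>\<^sub>0(N + 1) - 1)\<close> products.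
\<close>

definition small_divisors :: "nat \<Rightarrow> nat set" where
  "small_divisors N = {e. e < N \<and> e dvd N * (N + 1)}"

text \<open>A form that can be evaluated, which settles the values at \<open>2\<close>, \<open>3\<close> and \<open>4\<close>.\<close>

lemma small_divisors_eq_filter: "small_divisors N = Set.filter (\<lambda>e. e dvd N * (N + 1)) {..<N}"
  by (auto simp: small_divisors_def)

lemma finite_small_divisors: "finite (small_divisors N)"
  by (simp add: small_divisors_def)

lemma small_divisor_pos: "e > 0" if "e \<in> small_divisors N"
  using that by (auto simp: small_divisors_def intro: Nat.gr0I)

lemma sol_pairs_iff:
  "(d, i) \<in> sol_pairs N \<longleftrightarrow> d \<ge> 1 \<and> i \<ge> 2 \<and> (i - 1) * (int N - d) = d * (d + 1)"
proof (cases "i \<ge> 2")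
  case True
  then have "real_of_int (i - 1) \<noteq> 0" by simp
  then have "real N = real_of_int (d * (d + i)) / real_of_int (i - 1) \<longleftrightarrow>
      real_of_int (int N * (i - 1)) = real_of_int (d * (d + i))"
    by (simp add: eq_divide_eq)
  also have "\<dots> \<longleftrightarrow> int N * (i - 1) = d * (d + i)"
    by (simp only: of_int_eq_iff)
  also have "\<dots> \<longleftrightarrow> (i - 1) * (int N - d) = d * (d + 1)"
    by (auto simp: algebra_simps)
  finally show ?thesis
    by (simp add: sol_pairs_def)
qed (simp add: sol_pairs_def)

text \<open>This is the congruence \<open>N - e \<equiv> N\<close> modulo \<open>e\<close>.\<close>

lemma dvd_shifted_consecutive_iff:
  "e dvd (n - e) * (n - e + 1) \<longleftrightarrow> e dvd n * (n + 1)" for e n :: int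
proof -
  have "n * (n + 1) = (n - e) * (n - e + 1) + e * (2 * n - e + 1)"
    by (simp add: algebra_simps)
  then show ?thesis
    by (metis dvd_add_left_iff dvd_triv_left)
qed

lemma D_count_eq_card_small_divisors: "D_count N = card (small_divisors N)"
proof -
  have "bij_betw (\<lambda>(d, i). nat (int N - d)) (sol_pairs N) (small_divisors N)"
    unfolding bij_betw_def
  proof
    have less: "d < int N" if "(d, i) \<in> sol_pairs N" for d i
    proof -
      from that have "d \<ge> 1" "i - 1 > 0" and eq: "(i - 1) * (int N - d) = d * (d + 1)"
        by (auto simp: sol_pairs_iff)
      then have "(i - 1) * (int N - d) > 0"
        by simp
      with \<open>i - 1 > 0\<close> show ?thesis
        by (simp add: zero_less_mult_iff)
    qed
    show "inj_on (\<lambda>(d, i). nat (int N - d)) (sol_pairs N)"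
    proof (rule inj_onI, clarify)
      fix d i d' i'
      assume s: "(d, i) \<in> sol_pairs N" and s': "(d', i') \<in> sol_pairs N"
        and "nat (int N - d) = nat (int N - d')"
      then have "d = d'"
        using less[OF s] less[OF s'] by simp
      then have "(i - 1) * (int N - d) = (i' - 1) * (int N - d)"
        using s s' by (simp add: sol_pairs_iff)
      then show "d = d' \<and> i = i'"
        using \<open>d = d'\<close> less[OF s] by simp
    qed
    show "(\<lambda>(d, i). nat (int N - d)) ` sol_pairs N = small_divisors N"
    proof (intro subset_antisym subsetI)
      fix e assume "e \<in> (\<lambda>(d, i). nat (int N - d)) ` sol_pairs N"
      then obtain d i where s: "(d, i) \<in> sol_pairs N" and e: "e = nat (int N - d)"
        by auto
      from e less[OF s] have d: "d = int N - int e" by simp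
      from s have "d \<ge> 1" and "(i - 1) * int e = d * (d + 1)"
        by (simp_all add: sol_pairs_iff d)
      then have "int e dvd d * (d + 1)"
        by (metis dvd_triv_right)
      then have "int e dvd int N * (int N + 1)"
        by (simp only: d dvd_shifted_consecutive_iff)
      then have "int e dvd int (N * (N + 1))"
        by (simp add: algebra_simps)
      then have "e dvd N * (N + 1)"
        by (simp only: int_dvd_int_iff)
      with \<open>d \<ge> 1\<close> d show "e \<in> small_divisors N"
        by (simp add: small_divisors_def)
    next
      fix e assume e: "e \<in> small_divisors N"
      define d where "d = int N - int e"
      have "d \<ge> 1" and "e dvd N * (N + 1)"
        using e by (auto simp: small_divisors_def d_def)
      then have "int e dvd int (N * (N + 1))"
        by (simp only: int_dvd_int_iff)
      then have "int e dvd int N * (int N + 1)"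
        by (simp add: algebra_simps)
      then have "int e dvd d * (d + 1)"
        by (simp only: d_def dvd_shifted_consecutive_iff)
      then obtain j where j: "d * (d + 1) = int e * j" ..
      from \<open>d \<ge> 1\<close> have "int e * j > 0"
        by (simp flip: j)
      then have "j > 0"
        by (simp add: zero_less_mult_iff)
      with \<open>d \<ge> 1\<close> j have "(d, j + 1) \<in> sol_pairs N"
        by (simp add: sol_pairs_iff d_def mult.commute)
      moreover have "e = nat (int N - d)"
        by (simp add: d_def)
      ultimately show "e \<in> (\<lambda>(d, i). nat (int N - d)) ` sol_pairs N"
        by (auto intro: rev_image_eqI)
    qed
  qed
  then show ?thesis
    unfolding D_count_def by (rule bij_betw_same_card)
qed

lemma card_proper_divisors: "int (card ({a. a dvd n} - {n})) = int (sigma0 n) - 1" if "n > 0"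
proof -
  have "sigma0 n = card {a. a dvd n}"
    by (simp add: sigma0_def)
  moreover have "card {a. a dvd n} > 0"
    using that by (auto simp: card_gt_0_iff)
  ultimately show ?thesis
    by (simp add: card_Diff_singleton)
qed

text \<open>
  Multiplication maps the pairs of proper divisors of \<open>N\<close> and of \<open>N + 1\<close> onto a set that contains
  all small divisors: a factor \<open>N\<close> or \<open>N + 1\<close> would already make the product too large.
\<close>

lemma card_small_divisors_le: "int (card (small_divisors N)) \<le> M_bound N" if "N > 0"
proof -
  let ?A = "{a. a dvd N} - {N}" and ?B = "{b. b dvd N + 1} - {N + 1}"
  have fin: "finite (?A \<times> ?B)"
    using that by simp
  have "small_divisors N \<subseteq> (\<lambda>(a, b). a * b) ` (?A \<times> ?B)"
  proof
    fix e assume e: "e \<in> small_divisors N"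
    then obtain a b where ab: "e = a * b" "a dvd N" "b dvd N + 1"
      unfolding small_divisors_def using division_decomp by blast
    have "a > 0" "b > 0"
      using small_divisor_pos[OF e] ab by auto
    then have "a \<le> e" "b \<le> e"
      by (simp_all add: ab)
    moreover have "e < N"
      using e by (simp add: small_divisors_def)
    ultimately have "a \<noteq> N" "b \<noteq> N + 1"
      by auto
    with ab show "e \<in> (\<lambda>(a, b). a * b) ` (?A \<times> ?B)"
      by auto
  qed
  then have "card (small_divisors N) \<le> card (?A \<times> ?B)"
    using fin by (rule surj_card_le[rotated])
  then have "int (card (small_divisors N)) \<le> int (card ?A) * int (card ?B)"
    unfolding card_cartesian_product by (metis of_nat_le_iff of_nat_mult)
  then show ?thesis
    using that by (simp only: card_proper_divisors M_bound_def)
qed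

lemma three_le_card_small_divisors: "3 \<le> card (small_divisors N)" if "N \<ge> 5"
proof -
  \<comment> \<open>Half of the even one of \<open>N\<close> and \<open>N + 1\<close>; for \<open>N = 5\<close> and \<open>N = 6\<close> it is \<open>3\<close>, so it
    exceeds \<open>2\<close> throughout.\<close>
  define h where "h = (N + 1) div 2"
  have "even (N * (N + 1))"
    by simp
  moreover have "h dvd N * (N + 1)"
  proof (cases "even N")
    case True
    then have "N = h * 2" by (simp add: h_def)
    then show ?thesis by (metis dvd_mult2 dvd_triv_left)
  next
    case False
    then have "N + 1 = h * 2" unfolding h_def by presburger
    then show ?thesis by (metis dvd_mult dvd_triv_left)
  qed
  moreover have "2 < h" "h < N"
    using that by (auto simp: h_def)
  ultimately have "{1, 2, h} \<subseteq> small_divisors N"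
    using that by (auto simp: small_divisors_def)
  then have "card {1, 2, h} \<le> card (small_divisors N)"
    by (rule card_mono[OF finite_small_divisors])
  then show ?thesis
    using \<open>2 < h\<close> by simp
qed

theorem proposition2:
  shows "D_count 2 = 1 \<and> D_count 3 = 2 \<and> D_count 4 = 2 \<and>
    (\<forall>N::nat. N \<ge> 5 \<longrightarrow> 3 \<le> D_count N \<and> int (D_count N) \<le> M_bound N)"
proof -
  have "small_divisors 2 = {1}" "small_divisors 3 = {1, 2}" "small_divisors 4 = {1, 2}"
    by (simp_all only: small_divisors_eq_filter) code_simp+
  then show ?thesis
    by (simp add: D_count_eq_card_small_divisors three_le_card_small_divisors
        card_small_divisors_le)
qed

end
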